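(* Let $n\ge 3$ be an integer, let $E_1,\dots,E_{n-2},F_1,\dots,F_{n-2}$ be the Chevalley generators of $\mathfrak{sl}_{n-1}(\mathbb C)$, and let $\rho_m:U(\mathfrak{sl}_{n-1})\to\mathrm{End}(\mathbb C^m)$ be a finite-dimensional highest weight representation. Then the assignment $$\sigma_1\mapsto\exp(-\rho_m(F_1)),\qquad \sigma_k\mapsto\exp\left(\rho_m(E_{k-1}-F_k)\right)\ (2\le k\le n-2),\qquad \sigma_{n-1}\mapsto\exp(\rho_m(E_{n-2}))$$ defines a representation of the braid group $B_n$ on $\mathbb C^m$.
   Context: The braid group $B_n$ is generated by $\sigma_1,\dots,\sigma_{n-1}$ with relations $\sigma_i\sigma_{i+1}\sigma_i=\sigma_{i+1}\sigma_i\sigma_{i+1}$ for $1\le i\le n-2$ and $\sigma_i\sigma_j=\sigma_j\sigma_i$ for $|i-j|\ge2$. The Chevalley generators of $\mathfrak{sl}_{n-1}(\mathbb C)$ are, in the standard $(n-1)$-dimensional representation, the matrix units $E_i=e_{i,i+1}$ and $F_i=e_{i+1,i}$ for $1\le i\le n-2$. $U(\mathfrak{sl}_{n-1})$ is the universal enveloping algebra (the case $q=1$ of $U_q(\mathfrak{sl}_{n-1})$), and $\exp$ is the usual matrix exponential. *)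

theory Defs
  imports Complex_Main "HOL-Algebra.QuotRing" "Jordan_Normal_Form.Matrix"
begin

section \<open>Groups given by generators and relations\<close>

text \<open>A letter \<open>(x, True)\<close> stands for the generator \<open>x\<close>, and \<open>(x, False)\<close> for its formal inverse.\<close>

type_synonym 'x word = "('x \<times> bool) list"

definition words :: "'x set \<Rightarrow> 'x word set" where
  "words X = lists (X \<times> UNIV)"

inductive pres_eq :: "'x set \<Rightarrow> ('x word \<times> 'x word) set \<Rightarrow> 'x word \<Rightarrow> 'x word \<Rightarrow> bool"
  for X :: "'x set" and R :: "('x word \<times> 'x word) set" where
  refl: "w \<in> words X \<Longrightarrow> pres_eq X R w w"
| sym: "pres_eq X R v w \<Longrightarrow> pres_eq X R w v"
| trans: "pres_eq X R u v \<Longrightarrow> pres_eq X R v w \<Longrightarrow> pres_eq X R u w"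
| cancel: "u \<in> words X \<Longrightarrow> v \<in> words X \<Longrightarrow> x \<in> X \<Longrightarrow>
    pres_eq X R (u @ [(x, b), (x, \<not> b)] @ v) (u @ v)"
| rel: "u \<in> words X \<Longrightarrow> v \<in> words X \<Longrightarrow> (l, r) \<in> R \<Longrightarrow> l \<in> words X \<Longrightarrow> r \<in> words X \<Longrightarrow>
    pres_eq X R (u @ l @ v) (u @ r @ v)"

definition pres_class :: "'x set \<Rightarrow> ('x word \<times> 'x word) set \<Rightarrow> 'x word \<Rightarrow> 'x word set" where
  "pres_class X R w = {w'. pres_eq X R w w'}"

definition presented_group :: "'x set \<Rightarrow> ('x word \<times> 'x word) set \<Rightarrow> 'x word set monoid" where
  "presented_group X R =
    \<lparr>carrier = pres_class X R ` words X,
     monoid.mult = (\<lambda>P Q. \<Union>p\<in>P. \<Union>q\<in>Q. pres_class X R (p @ q)),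
     one = pres_class X R []\<rparr>"

section \<open>The braid group\<close>

definition braid_relations :: "nat \<Rightarrow> (nat word \<times> nat word) set" where
  "braid_relations n =
     {([(i, True), (i + 1, True), (i, True)], [(i + 1, True), (i, True), (i + 1, True)]) | i.
        i \<in> {1..n - 2}}
   \<union> {([(i, True), (j, True)], [(j, True), (i, True)]) | i j.
        i \<in> {1..n - 1} \<and> j \<in> {1..n - 1} \<and> \<bar>int i - int j\<bar> \<ge> 2}"

definition braid_group :: "nat \<Rightarrow> nat word set monoid" where
  "braid_group n = presented_group {1..n - 1} (braid_relations n)"

definition braid_gen :: "nat \<Rightarrow> nat \<Rightarrow> nat word set" where
  "braid_gen n i = pres_class {1..n - 1} (braid_relations n) [(i, True)]"

section \<open>Universal enveloping algebras over the complex numbers\<close>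

text \<open>The free unital associative algebra on a set \<open>X\<close>: its elements are the finitely supported
  coefficient functions on the free monoid of words over \<open>X\<close>.\<close>

definition free_alg :: "'x set \<Rightarrow> (complex, 'x list \<Rightarrow> complex) module" where
  "free_alg X =
    \<lparr>carrier = {f. finite {w. f w \<noteq> 0} \<and> {w. f w \<noteq> 0} \<subseteq> lists X},
     monoid.mult = (\<lambda>f g w. \<Sum>k\<le>length w. f (take k w) * g (drop k w)),
     one = (\<lambda>w. if w = [] then 1 else 0),
     zero = (\<lambda>w. 0),
     add = (\<lambda>f g w. f w + g w),
     smult = (\<lambda>c f w. c * f w)\<rparr>"

definition monomial :: "'x list \<Rightarrow> 'x list \<Rightarrow> complex" where
  "monomial v = (\<lambda>w. if w = v then 1 else 0)"

text \<open>A Lie algebra is given by a vector space \<open>L\<close> (its ring multiplication and unit are not used)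
  and a bracket \<open>br\<close>. The linearity relations turn the free algebra on the underlying set of \<open>L\<close>
  into the tensor algebra of \<open>L\<close>; the last relation is \<open>x \<otimes> y - y \<otimes> x = [x, y]\<close>.\<close>

definition env_relators ::
  "(complex, 'x) module \<Rightarrow> ('x \<Rightarrow> 'x \<Rightarrow> 'x) \<Rightarrow> ('x list \<Rightarrow> complex) set" where
  "env_relators L br =
     {(\<lambda>w. monomial [x \<oplus>\<^bsub>L\<^esub> y] w - monomial [x] w - monomial [y] w) | x y.
        x \<in> carrier L \<and> y \<in> carrier L}
   \<union> {(\<lambda>w. monomial [c \<odot>\<^bsub>L\<^esub> x] w - c * monomial [x] w) | c x. x \<in> carrier L}
   \<union> {(\<lambda>w. monomial [x, y] w - monomial [y, x] w - monomial [br x y] w) | x y.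
        x \<in> carrier L \<and> y \<in> carrier L}"

definition env_ideal ::
  "(complex, 'x) module \<Rightarrow> ('x \<Rightarrow> 'x \<Rightarrow> 'x) \<Rightarrow> ('x list \<Rightarrow> complex) set" where
  "env_ideal L br = Idl\<^bsub>free_alg (carrier L)\<^esub> (env_relators L br)"

text \<open>The quotient ring, with the scalar multiplication induced on cosets.\<close>

definition env_alg ::
  "(complex, 'x) module \<Rightarrow> ('x \<Rightarrow> 'x \<Rightarrow> 'x) \<Rightarrow> (complex, ('x list \<Rightarrow> complex) set) module" where
  "env_alg L br =
    ring.extend (free_alg (carrier L) Quot env_ideal L br)
      (module.fields
        (\<lambda>c P. \<Union>f\<in>P. env_ideal L br +>\<^bsub>free_alg (carrier L)\<^esub> (c \<odot>\<^bsub>free_alg (carrier L)\<^esub> f)))"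

definition env_incl ::
  "(complex, 'x) module \<Rightarrow> ('x \<Rightarrow> 'x \<Rightarrow> 'x) \<Rightarrow> 'x \<Rightarrow> ('x list \<Rightarrow> complex) set" where
  "env_incl L br x = env_ideal L br +>\<^bsub>free_alg (carrier L)\<^esub> monomial [x]"

section \<open>The special linear Lie algebra and its enveloping algebra\<close>

definition sl :: "nat \<Rightarrow> (complex, complex mat) module" where
  "sl N = (module_mat TYPE(complex) N N)
     \<lparr>carrier := {A \<in> carrier_mat N N. (\<Sum>i<N. A $$ (i, i)) = 0}\<rparr>"

definition commutator :: "complex mat \<Rightarrow> complex mat \<Rightarrow> complex mat" where
  "commutator A B = A * B - B * A"

text \<open>Rows and columns are numbered from 1 here, whereas the matrix library numbers them from 0.\<close>

definition matrix_unit :: "nat \<Rightarrow> nat \<Rightarrow> nat \<Rightarrow> complex mat" where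
  "matrix_unit N i j = mat N N (\<lambda>(a, b). if a + 1 = i \<and> b + 1 = j then 1 else 0)"

type_synonym env = "(complex mat list \<Rightarrow> complex) set"

definition U_sl :: "nat \<Rightarrow> (complex, env) module" where
  "U_sl N = env_alg (sl N) commutator"

definition U_incl :: "nat \<Rightarrow> complex mat \<Rightarrow> env" where
  "U_incl N = env_incl (sl N) commutator"

definition chev_E :: "nat \<Rightarrow> nat \<Rightarrow> env" where
  "chev_E N i = U_incl N (matrix_unit N i (i + 1))"

definition chev_F :: "nat \<Rightarrow> nat \<Rightarrow> env" where
  "chev_F N i = U_incl N (matrix_unit N (i + 1) i)"

section \<open>Representations\<close>

text \<open>Unital complex-algebra homomorphisms into the \<open>m \<times> m\<close> matrices.\<close>

definition is_rep :: "nat \<Rightarrow> nat \<Rightarrow> (env \<Rightarrow> complex mat) \<Rightarrow> bool" where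
  "is_rep N m \<rho> \<longleftrightarrow>
     \<rho> \<in> Ring.ring_hom (U_sl N) (ring_mat TYPE(complex) m ()) \<and>
     (\<forall>c. \<forall>u\<in>carrier (U_sl N). \<rho> (c \<odot>\<^bsub>U_sl N\<^esub> u) = c \<cdot>\<^sub>m \<rho> u)"

text \<open>The Cartan subalgebra consists of the diagonal matrices in \<open>sl N\<close>. The weight \<open>\<mu>\<close> is
  automatically linear on it because \<open>v \<noteq> 0\<close>.\<close>

definition highest_weight_rep :: "nat \<Rightarrow> nat \<Rightarrow> (env \<Rightarrow> complex mat) \<Rightarrow> bool" where
  "highest_weight_rep N m \<rho> \<longleftrightarrow> is_rep N m \<rho> \<and>
     (\<exists>v \<in> carrier_vec m. \<exists>\<mu> :: complex mat \<Rightarrow> complex.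
        v \<noteq> 0\<^sub>v m \<and>
        (\<forall>i\<in>{1..N - 1}. \<rho> (chev_E N i) *\<^sub>v v = 0\<^sub>v m) \<and>
        (\<forall>H\<in>carrier (sl N). diagonal_mat H \<longrightarrow> \<rho> (U_incl N H) *\<^sub>v v = \<mu> H \<cdot>\<^sub>v v) \<and>
        {\<rho> u *\<^sub>v v | u. u \<in> carrier (U_sl N)} = carrier_vec m)"

section \<open>The matrix exponential\<close>

definition mat_exp :: "complex mat \<Rightarrow> complex mat" where
  "mat_exp A = mat (dim_row A) (dim_col A) (\<lambda>(i, j). \<Sum>k. (A ^\<^sub>m k) $$ (i, j) / fact k)"

definition GL :: "nat \<Rightarrow> complex mat monoid" where
  "GL m = units_of (ring_mat TYPE(complex) m ())"

end

(* Let N = n - 1. In the standard representation of sl_N put X_k = e_{k-1,k} - e_{k+1,k}, where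
   matrix units with an index out of range vanish; then sigma_k is sent to exp(rho(X_k)). Each X_k
   has a single nonzero column, so X_k X_k = 0, X_j X_k = 0 for |j - k| >= 2, and
   X_j X_k X_j = - X_j for |j - k| = 1. Hence X_j and X_k commute for |j - k| >= 2, and for
   p = X_k, q = X_{k+1}, h = [p, q] one has [p, h] = 2 p and [q, h] = -2 q. These are identities
   between brackets, so they survive in every representation. By exp(x) y exp(-x) = exp(ad x)(y)
   they show that conjugation by exp(q) exp(p) exp(q) maps q to p, hence exp(q) to exp(p), which is
   the braid relation. *)

theory Submission
  imports Defs
begin

section \<open>Homomorphisms out of a presented group\<close>

text \<open>The relations say that (q, -p, h) is an sl_2-triple: [h, q] = 2 q, [h, -p] = -2 (-p) and
  [q, -p] = h. So exp(q) exp(p) exp(q) is the classical representative of the nontrivial Weyl group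
  element of SL_2, which exchanges the two root lines; this is why it carries q to p. The obstacle
  is that the matrix products hold only in the standard representation. The image of X_k in another
  representation need not square to zero, so its exponential has to be handled as a genuine power
  series. What stays finite is the adjoint action: [p, [p, [p, q]]] = 0 holds in every
  representation, hence conjugation by exp(p) applied to q stops after the second-order term.
  Likewise the enveloping algebra enters only through linearity and x y - y x = [x, y], since no
  other product of matrices survives the passage to it.\<close>

definition word_eval :: "('g, 'b) monoid_scheme \<Rightarrow> ('x \<Rightarrow> 'g) \<Rightarrow> 'x word \<Rightarrow> 'g" where
  "word_eval G h w =
     foldr (\<lambda>(x, b) g. (if b then h x else inv\<^bsub>G\<^esub> h x) \<otimes>\<^bsub>G\<^esub> g) w \<one>\<^bsub>G\<^esub>"

lemma pres_eq_words: "pres_eq X R v w \<Longrightarrow> v \<in> words X \<and> w \<in> words X"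
  by (induction rule: pres_eq.induct) (auto simp: words_def)

context group
begin

lemma word_eval_closed:
  assumes "h ` X \<subseteq> carrier G" "w \<in> words X"
  shows "word_eval G h w \<in> carrier G"
  using assms(2) unfolding words_def
  by (induction w) (use assms(1) in \<open>auto simp: word_eval_def\<close>)

lemma word_eval_append:
  assumes "h ` X \<subseteq> carrier G" "v \<in> words X" "w \<in> words X"
  shows "word_eval G h (v @ w) = word_eval G h v \<otimes> word_eval G h w"
  using assms(2)
proof (induction v)
  case Nil
  then show ?case
    using word_eval_closed[OF assms(1,3)] by (simp add: word_eval_def)
next
  case (Cons a v)
  obtain x b where a: "a = (x, b)" by (cases a)
  have "x \<in> X" and v: "v \<in> words X"
    using Cons.prems by (auto simp: words_def a)
  then have "h x \<in> carrier G" using assms(1) by auto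
  moreover have "word_eval G h (a # u) = (if b then h x else inv h x) \<otimes> word_eval G h u" for u
    by (simp add: word_eval_def a)
  ultimately show ?case
    using Cons.IH[OF v] word_eval_closed[OF assms(1) v] word_eval_closed[OF assms(1,3)]
    by (simp add: m_assoc)
qed

text \<open>Induction over the congruence: a cancelled pair evaluates to the identity in either
  order, and a relator may be replaced inside a longer word because evaluation is
  multiplicative.\<close>

lemma word_eval_pres_eq:
  assumes h: "h ` X \<subseteq> carrier G"
    and R: "\<And>l r. (l, r) \<in> R \<Longrightarrow> word_eval G h l = word_eval G h r"
    and "pres_eq X R v w"
  shows "word_eval G h v = word_eval G h w"
  using assms(3)
proof (induction rule: pres_eq.induct)
  case (cancel u v x b)
  have x: "h x \<in> carrier G" using h cancel by auto
  have w: "[(x, b), (x, \<not> b)] \<in> words X" using cancel by (auto simp: words_def)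
  then have "[(x, b), (x, \<not> b)] @ v \<in> words X" using cancel by (auto simp: words_def)
  moreover have "word_eval G h [(x, b), (x, \<not> b)] = \<one>"
    using x by (cases b) (auto simp: word_eval_def)
  ultimately show ?case
    using cancel w h by (simp add: word_eval_append word_eval_closed del: append.simps)
next
  case (rel u v l r)
  then have "l @ v \<in> words X" "r @ v \<in> words X" by (auto simp: words_def)
  then show ?case
    using rel h R[OF rel(3)] by (simp add: word_eval_append)
qed simp_all

text \<open>The value on a class is read off an arbitrary representative. A product of classes is a
  nonempty set of words with the same value, so it need not be known to be a single class.\<close>

lemma presented_group_hom_exists:
  assumes h: "h ` X \<subseteq> carrier G"
    and R: "\<And>l r. (l, r) \<in> R \<Longrightarrow> word_eval G h l = word_eval G h r"
  shows "\<exists>\<phi> \<in> hom (presented_group X R) G.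
    \<forall>x\<in>X. \<phi> (pres_class X R [(x, True)]) = h x"
proof -
  define \<phi> where "\<phi> P = word_eval G h (SOME w. w \<in> P)" for P
  have \<phi>: "\<phi> P = g" if "w \<in> P" "\<And>w. w \<in> P \<Longrightarrow> word_eval G h w = g" for P w g
    unfolding \<phi>_def using that by (metis someI)
  have self: "w \<in> pres_class X R w" if "w \<in> words X" for w
    using that by (simp add: pres_class_def pres_eq.refl)
  have eval: "word_eval G h v = word_eval G h w" if "v \<in> pres_class X R w" for v w
    using word_eval_pres_eq[OF h R] that by (fastforce simp: pres_class_def)
  have rep: "\<phi> (pres_class X R w) = word_eval G h w" if "w \<in> words X" for w
    using self[OF that] eval by (rule \<phi>)
  have "\<phi> (P \<otimes>\<^bsub>presented_group X R\<^esub> Q) = \<phi> P \<otimes> \<phi> Q"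
    if PQ: "P \<in> carrier (presented_group X R)" "Q \<in> carrier (presented_group X R)" for P Q
  proof -
    obtain p q where p: "p \<in> words X" "P = pres_class X R p"
      and q: "q \<in> words X" "Q = pres_class X R q"
      using PQ by (auto simp: presented_group_def)
    have pq: "p @ q \<in> words X" using p q by (auto simp: words_def)
    have "\<phi> (P \<otimes>\<^bsub>presented_group X R\<^esub> Q) = word_eval G h p \<otimes> word_eval G h q"
    proof (rule \<phi>)
      show "p @ q \<in> P \<otimes>\<^bsub>presented_group X R\<^esub> Q"
        using self p q self[OF pq] by (auto simp: presented_group_def)
    next
      fix w assume "w \<in> P \<otimes>\<^bsub>presented_group X R\<^esub> Q"
      then obtain p' q' where *: "p' \<in> P" "q' \<in> Q" "w \<in> pres_class X R (p' @ q')"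
        by (auto simp: presented_group_def)
      have "p' \<in> words X" "q' \<in> words X"
        using * p q pres_eq_words by (auto simp: pres_class_def)
      then show "word_eval G h w = word_eval G h p \<otimes> word_eval G h q"
        using eval[OF *(3)] eval * p q h by (metis word_eval_append)
    qed
    then show ?thesis using rep p q by simp
  qed
  moreover have "\<phi> P \<in> carrier G" if "P \<in> carrier (presented_group X R)" for P
    using that rep word_eval_closed[OF h] by (auto simp: presented_group_def)
  ultimately have "\<phi> \<in> hom (presented_group X R) G" by (auto simp: hom_def)
  moreover have "\<phi> (pres_class X R [(x, True)]) = h x" if "x \<in> X" for x
    using rep[of "[(x, True)]"] that h by (auto simp: words_def word_eval_def)
  ultimately show ?thesis by blast
qed

end

section \<open>The free algebra and the enveloping algebra\<close>

definition conv :: "('x list \<Rightarrow> complex) \<Rightarrow> ('x list \<Rightarrow> complex) \<Rightarrow> 'x list \<Rightarrow> complex" where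
  "conv f g w = (\<Sum>k\<le>length w. f (take k w) * g (drop k w))"

text \<open>Both sides sum over the cuts of a word into three consecutive blocks;
  \<open>T i j\<close> is the term whose first two blocks have lengths \<open>i\<close> and
  \<open>j\<close>. A word has finitely many cuts, so the identity holds for arbitrary coefficient
  functions.\<close>

lemma conv_assoc: "conv (conv f g) h = conv f (conv g h)"
proof
  fix w :: "'a list"
  define T where "T i j = f (take i w) * (g (take j (drop i w)) * h (drop (i + j) w))" for i j
  have "conv (conv f g) h w = (\<Sum>k\<le>length w. \<Sum>i\<le>k. T i (k - i))"
    unfolding conv_def T_def
    by (intro sum.cong HOL.refl) (auto simp: sum_distrib_right mult.assoc take_drop min_def
        intro!: sum.cong)
  also have "\<dots> = (\<Sum>(i, j)\<in>{(i, j). i + j \<le> length w}. T i j)"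
    by (rule sum.triangle_reindex_eq[symmetric])
  also have "{(i, j). i + j \<le> length w} = (SIGMA i:{..length w}. {..length w - i})"
    by auto
  also have "(\<Sum>(i, j)\<in>\<dots>. T i j) = (\<Sum>i\<le>length w. \<Sum>j\<le>length w - i. T i j)"
    by (simp add: sum.Sigma)
  also have "\<dots> = conv f (conv g h) w"
    unfolding conv_def T_def by (simp add: sum_distrib_left add.commute)
  finally show "conv (conv f g) h w = conv f (conv g h) w" .
qed

text \<open>Only the cut after \<open>length u\<close> letters can contribute.\<close>

lemma conv_monomial_monomial: "conv (monomial u) (monomial v) = monomial (u @ v)"
proof
  fix w :: "'a list"
  have "conv (monomial u) (monomial v) w =
      (\<Sum>k\<le>length w. if k = length u then monomial (u @ v) w else 0)"
    unfolding conv_def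
  proof (rule sum.cong[OF HOL.refl])
    fix k assume "k \<in> {..length w}"
    then have iff: "take k w = u \<and> drop k w = v \<longleftrightarrow> k = length u \<and> w = u @ v"
      by (metis append_eq_conv_conj append_take_drop_id atMost_iff length_take min.absorb2)
    have "monomial u (take k w) * monomial v (drop k w) =
        (if take k w = u \<and> drop k w = v then 1 else 0)"
      by (simp add: monomial_def)
    then show "monomial u (take k w) * monomial v (drop k w) =
        (if k = length u then monomial (u @ v) w else 0)"
      unfolding iff by (simp add: monomial_def)
  qed
  also have "\<dots> = (if length u \<le> length w then monomial (u @ v) w else 0)" by simp
  also have "\<dots> = monomial (u @ v) w" by (auto simp: monomial_def)
  finally show "conv (monomial u) (monomial v) w = monomial (u @ v) w" .
qed

text \<open>Scalars are the multiples of the empty word. Allowing any \<open>c\<close> here, not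
  only 1, turns scalar multiplication into a ring product, which \<open>smult_coset\<close> relies
  on.\<close>

lemma conv_scalar_left: "conv (\<lambda>w. if w = [] then c else 0) f = (\<lambda>w. c * f w)"
proof
  fix w :: "'a list"
  have "conv (\<lambda>w. if w = [] then c else 0) f w = (\<Sum>k\<le>length w. if k = 0 then c * f w else 0)"
    unfolding conv_def by (intro sum.cong HOL.refl) auto
  then show "conv (\<lambda>w. if w = [] then c else 0) f w = c * f w" by simp
qed

lemma conv_one_right: "conv f (\<lambda>w. if w = [] then 1 else 0) = f"
proof
  fix w :: "'a list"
  have "conv f (\<lambda>w. if w = [] then 1 else 0) w = (\<Sum>k\<le>length w. if k = length w then f w else 0)"
    unfolding conv_def by (intro sum.cong HOL.refl) auto
  then show "conv f (\<lambda>w. if w = [] then 1 else 0) w = f w" by simp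
qed

text \<open>A nonzero value at \<open>w\<close> needs a nonzero summand, which exhibits
  \<open>w\<close> as a concatenation of words from the two supports.\<close>

lemma conv_closed:
  assumes f: "finite {w. f w \<noteq> 0}" "{w. f w \<noteq> 0} \<subseteq> lists X"
    and g: "finite {w. g w \<noteq> 0}" "{w. g w \<noteq> 0} \<subseteq> lists X"
  shows "finite {w. conv f g w \<noteq> 0}" "{w. conv f g w \<noteq> 0} \<subseteq> lists X"
proof -
  let ?S = "(\<lambda>(u, v). u @ v) ` ({w. f w \<noteq> 0} \<times> {w. g w \<noteq> 0})"
  have S: "{w. conv f g w \<noteq> 0} \<subseteq> ?S"
  proof
    fix w assume "w \<in> {w. conv f g w \<noteq> 0}"
    then obtain k where "f (take k w) * g (drop k w) \<noteq> 0"
      unfolding conv_def by (auto elim: sum.not_neutral_contains_not_neutral)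
    then show "w \<in> ?S" by (intro image_eqI[of _ _ "(take k w, drop k w)"]) auto
  qed
  then show "finite {w. conv f g w \<noteq> 0}"
    using f(1) g(1) by (meson finite_SigmaI finite_imageI finite_subset)
  have "?S \<subseteq> lists X" using f(2) g(2) by (fastforce simp: subset_eq in_lists_conv_set)
  with S show "{w. conv f g w \<noteq> 0} \<subseteq> lists X" by (rule order_trans)
qed

lemma free_alg_simps:
  "carrier (free_alg X) = {f. finite {w. f w \<noteq> 0} \<and> {w. f w \<noteq> 0} \<subseteq> lists X}"
  "f \<otimes>\<^bsub>free_alg X\<^esub> g = conv f g"
  "\<one>\<^bsub>free_alg X\<^esub> = (\<lambda>w. if w = [] then 1 else 0)"
  "\<zero>\<^bsub>free_alg X\<^esub> = (\<lambda>w. 0)"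
  "f \<oplus>\<^bsub>free_alg X\<^esub> g = (\<lambda>w. f w + g w)"
  "c \<odot>\<^bsub>free_alg X\<^esub> f = (\<lambda>w. c * f w)"
  by (simp_all add: free_alg_def conv_def fun_eq_iff)

lemma lincomb_free_alg_closed:
  assumes "f \<in> carrier (free_alg X)" "g \<in> carrier (free_alg X)"
  shows "(\<lambda>w. a * f w + b * g w) \<in> carrier (free_alg X)"
proof -
  have "{w. a * f w + b * g w \<noteq> 0} \<subseteq> {w. f w \<noteq> 0} \<union> {w. g w \<noteq> 0}" by auto
  moreover have "finite ({w. f w \<noteq> 0} \<union> {w. g w \<noteq> 0})"
    "{w. f w \<noteq> 0} \<union> {w. g w \<noteq> 0} \<subseteq> lists X"
    using assms by (auto simp: free_alg_simps)
  ultimately show ?thesis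
    unfolding free_alg_simps by (blast intro: finite_subset)
qed

lemma smult_free_alg_closed:
  assumes "f \<in> carrier (free_alg X)"
  shows "(\<lambda>w. a * f w) \<in> carrier (free_alg X)"
  using lincomb_free_alg_closed[OF assms assms, of a 0] by simp

lemma diff_free_alg_closed:
  assumes "f \<in> carrier (free_alg X)" "g \<in> carrier (free_alg X)"
  shows "(\<lambda>w. f w - g w) \<in> carrier (free_alg X)"
  using lincomb_free_alg_closed[OF assms, of 1 "-1"] by simp

lemma scalar_free_alg_closed: "(\<lambda>w. if w = [] then c else 0) \<in> carrier (free_alg X)"
  by (auto simp: free_alg_simps)

lemma monomial_free_alg_closed: "w \<in> lists X \<Longrightarrow> monomial w \<in> carrier (free_alg X)"
  by (auto simp: free_alg_simps monomial_def)

lemma ring_free_alg: "ring (free_alg X)"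
proof (rule ringI)
  show "abelian_group (free_alg X)"
  proof (rule abelian_groupI)
    fix f g assume f: "f \<in> carrier (free_alg X)" and g: "g \<in> carrier (free_alg X)"
    show "f \<oplus>\<^bsub>free_alg X\<^esub> g \<in> carrier (free_alg X)"
      using lincomb_free_alg_closed[OF f g, of 1 1] by (simp add: free_alg_simps)
    have "(\<lambda>w. - f w) \<in> carrier (free_alg X)"
      using smult_free_alg_closed[OF f, of "-1"] by simp
    then show "\<exists>g\<in>carrier (free_alg X). g \<oplus>\<^bsub>free_alg X\<^esub> f = \<zero>\<^bsub>free_alg X\<^esub>"
      by (rule bexI[rotated]) (simp add: free_alg_simps)
  qed (auto simp: free_alg_simps add_ac)
  show "monoid (free_alg X)"
  proof (rule monoidI)
    fix f g assume "f \<in> carrier (free_alg X)" "g \<in> carrier (free_alg X)"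
    then show "f \<otimes>\<^bsub>free_alg X\<^esub> g \<in> carrier (free_alg X)"
      unfolding free_alg_simps using conv_closed[of f X g] by blast
  qed (auto simp: free_alg_simps conv_assoc conv_one_right conv_scalar_left)
qed (auto simp: free_alg_simps conv_def distrib_left distrib_right sum.distrib)

section \<open>The enveloping algebra of a vector space with a bracket\<close>

context
  fixes L :: "(complex, 'x) module" and br :: "'x \<Rightarrow> 'x \<Rightarrow> 'x"
  assumes closed: "\<And>x y. x \<in> carrier L \<Longrightarrow> y \<in> carrier L \<Longrightarrow> x \<oplus>\<^bsub>L\<^esub> y \<in> carrier L"
      "\<And>c x. x \<in> carrier L \<Longrightarrow> c \<odot>\<^bsub>L\<^esub> x \<in> carrier L"
      "\<And>x y. x \<in> carrier L \<Longrightarrow> y \<in> carrier L \<Longrightarrow> br x y \<in> carrier L"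
begin

text \<open>Closure of \<open>carrier L\<close> keeps all letters of the relators in the alphabet;
  without this the generated ideal could not be treated as an ideal of the free algebra.\<close>

lemma env_relators_subset: "env_relators L br \<subseteq> carrier (free_alg (carrier L))"
proof -
  note [simp] = diff_free_alg_closed monomial_free_alg_closed smult_free_alg_closed closed
  show ?thesis unfolding env_relators_def by auto
qed

lemma env_ideal_ideal: "ideal (env_ideal L br) (free_alg (carrier L))"
  unfolding env_ideal_def
  by (rule ring.genideal_ideal[OF ring_free_alg env_relators_subset])

lemma env_relators_in_ideal: "env_relators L br \<subseteq> env_ideal L br"
  unfolding env_ideal_def
  by (rule ring.genideal_self[OF ring_free_alg env_relators_subset])

lemma env_alg_simps:
  "carrier (env_alg L br) = carrier (free_alg (carrier L) Quot env_ideal L br)"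
  "monoid.mult (env_alg L br) = monoid.mult (free_alg (carrier L) Quot env_ideal L br)"
  "one (env_alg L br) = one (free_alg (carrier L) Quot env_ideal L br)"
  "zero (env_alg L br) = zero (free_alg (carrier L) Quot env_ideal L br)"
  "add (env_alg L br) = add (free_alg (carrier L) Quot env_ideal L br)"
  by (simp_all add: env_alg_def ring.defs)

text \<open>The quotient ring and \<open>env_alg\<close> are records of different types, so the
  axioms are carried over one by one.\<close>

lemma ring_env_alg: "ring (env_alg L br)"
proof -
  interpret Q: ring "free_alg (carrier L) Quot env_ideal L br"
    by (rule ideal.quotient_is_ring[OF env_ideal_ideal])
  show ?thesis
  proof (rule ringI)
    show "abelian_group (env_alg L br)"
      by (rule abelian_groupI)
        (auto simp: env_alg_simps Q.a_ac
          intro: Q.add.l_inv_ex[simplified])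
    show "monoid (env_alg L br)"
      by (rule monoidI) (auto simp: env_alg_simps Q.m_assoc)
  qed (auto simp: env_alg_simps Q.l_distr Q.r_distr)
qed

abbreviation coset :: "('x list \<Rightarrow> complex) \<Rightarrow> ('x list \<Rightarrow> complex) set" where
  "coset f \<equiv> env_ideal L br +>\<^bsub>free_alg (carrier L)\<^esub> f"

lemma coset_hom: "coset \<in> Ring.ring_hom (free_alg (carrier L)) (env_alg L br)"
  using ideal.rcos_ring_hom[OF env_ideal_ideal] by (simp add: Ring.ring_hom_def env_alg_simps)

text \<open>Scaling by \<open>c\<close> is multiplication by the coset of the constant
  \<open>c\<close>, so it depends only on the coset. The union in the definition of the scalar
  action therefore runs over equal sets, and its index set is nonempty.\<close>

lemma smult_coset:
  assumes f: "f \<in> carrier (free_alg (carrier L))"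
  shows "c \<odot>\<^bsub>env_alg L br\<^esub> coset f = coset (\<lambda>w. c * f w)"
proof -
  interpret I: ideal "env_ideal L br" "free_alg (carrier L)" by (rule env_ideal_ideal)
  let ?c = "\<lambda>w. if w = [] then c else 0"
  have scale: "coset (\<lambda>w. c * g w) = coset ?c \<otimes>\<^bsub>env_alg L br\<^esub> coset g"
    if "g \<in> carrier (free_alg (carrier L))" for g
    using ring_hom_mult[OF coset_hom scalar_free_alg_closed that, of c]
    by (simp add: free_alg_simps(2) conv_scalar_left)
  have "coset (\<lambda>w. c * g w) = coset (\<lambda>w. c * f w)" if g: "g \<in> coset f" for g
  proof -
    have gc: "g \<in> carrier (free_alg (carrier L))"
      using g I.a_r_coset_subset_G[OF I.a_subset f] by auto
    have "coset g = coset f"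
      using I.a_repr_independence'[OF g f] by simp
    then show ?thesis unfolding scale[OF gc] scale[OF f] by simp
  qed
  then have "(\<Union>g\<in>coset f. coset (\<lambda>w. c * g w)) = (\<Union>g\<in>coset f. coset (\<lambda>w. c * f w))"
    by (rule SUP_cong[OF HOL.refl])
  moreover have "coset f \<noteq> {}" using I.a_rcos_self[OF f] by blast
  moreover have "c \<odot>\<^bsub>env_alg L br\<^esub> coset f = (\<Union>g\<in>coset f. coset (\<lambda>w. c * g w))"
    by (simp add: env_alg_def ring.defs module.defs free_alg_simps(6))
  ultimately show ?thesis by (simp only: UN_constant if_False)
qed

lemma env_incl_closed: "x \<in> carrier L \<Longrightarrow> env_incl L br x \<in> carrier (env_alg L br)"
  unfolding env_incl_def by (intro ring_hom_closed[OF coset_hom] monomial_free_alg_closed) auto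

lemma coset_diff_eq:
  assumes "(\<lambda>w. f w - g w) \<in> env_ideal L br"
    and "f \<in> carrier (free_alg (carrier L))" "g \<in> carrier (free_alg (carrier L))"
  shows "coset f = coset g"
proof -
  interpret I: ideal "env_ideal L br" "free_alg (carrier L)" by (rule env_ideal_ideal)
  have "f = (\<lambda>w. f w - g w) \<oplus>\<^bsub>free_alg (carrier L)\<^esub> g" by (simp add: free_alg_simps)
  then have "f \<in> coset g"
    using assms(1) unfolding a_r_coset_def' by blast
  then show ?thesis using I.a_repr_independence'[OF _ assms(3)] by simp
qed

lemma env_incl_add:
  assumes x: "x \<in> carrier L" and y: "y \<in> carrier L"
  shows "env_incl L br (x \<oplus>\<^bsub>L\<^esub> y) = env_incl L br x \<oplus>\<^bsub>env_alg L br\<^esub> env_incl L br y"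
proof -
  note mono = monomial_free_alg_closed[of "[_]" "carrier L"]
  have "(\<lambda>w. monomial [x \<oplus>\<^bsub>L\<^esub> y] w - monomial [x] w - monomial [y] w) \<in> env_relators L br"
    unfolding env_relators_def
    by (rule UnI1, rule UnI1, intro CollectI exI[of _ x] exI[of _ y] conjI HOL.refl x y)
  note rel = subsetD[OF env_relators_in_ideal this]
  have "coset (monomial [x \<oplus>\<^bsub>L\<^esub> y]) = coset (\<lambda>w. monomial [x] w + monomial [y] w)"
  proof (rule coset_diff_eq)
    show "(\<lambda>w. monomial [x \<oplus>\<^bsub>L\<^esub> y] w - (monomial [x] w + monomial [y] w)) \<in> env_ideal L br"
      using rel by (simp only: diff_diff_eq)
  qed (use x y closed mono lincomb_free_alg_closed[OF mono mono, of x y 1 1] in auto)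
  also have "\<dots> = coset (monomial [x]) \<oplus>\<^bsub>env_alg L br\<^esub> coset (monomial [y])"
    using ring_hom_add[OF coset_hom, of "monomial [x]" "monomial [y]"] x y mono
    by (simp add: free_alg_simps(5))
  finally show ?thesis unfolding env_incl_def .
qed

lemma env_incl_smult:
  assumes x: "x \<in> carrier L"
  shows "env_incl L br (c \<odot>\<^bsub>L\<^esub> x) = c \<odot>\<^bsub>env_alg L br\<^esub> env_incl L br x"
proof -
  note mono = monomial_free_alg_closed[of "[_]" "carrier L"]
  have "coset (monomial [c \<odot>\<^bsub>L\<^esub> x]) = coset (\<lambda>w. c * monomial [x] w)"
  proof (rule coset_diff_eq)
    show "(\<lambda>w. monomial [c \<odot>\<^bsub>L\<^esub> x] w - c * monomial [x] w) \<in> env_ideal L br"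
      using env_relators_in_ideal x unfolding env_relators_def by blast
  qed (use x closed mono smult_free_alg_closed[OF mono, of x] in auto)
  then show ?thesis
    using x mono by (simp add: env_incl_def smult_coset)
qed

text \<open>Written with a sum instead of a difference, so that a ring homomorphism carries it to
  matrices by \<open>ring_hom_mult\<close> and \<open>ring_hom_add\<close> alone.\<close>

lemma env_incl_bracket:
  assumes x: "x \<in> carrier L" and y: "y \<in> carrier L"
  shows "env_incl L br x \<otimes>\<^bsub>env_alg L br\<^esub> env_incl L br y =
    env_incl L br y \<otimes>\<^bsub>env_alg L br\<^esub> env_incl L br x \<oplus>\<^bsub>env_alg L br\<^esub> env_incl L br (br x y)"
proof -
  note mono = monomial_free_alg_closed[of "[_]" "carrier L"]
  have mono2: "monomial [a, b] \<in> carrier (free_alg (carrier L))"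
    if "a \<in> carrier L" "b \<in> carrier L" for a b
    using that by (intro monomial_free_alg_closed) auto
  have prod: "env_incl L br a \<otimes>\<^bsub>env_alg L br\<^esub> env_incl L br b = coset (monomial [a, b])"
    if "a \<in> carrier L" "b \<in> carrier L" for a b
    using ring_hom_mult[OF coset_hom, of "monomial [a]" "monomial [b]"] that mono
    by (simp add: env_incl_def free_alg_simps(2) conv_monomial_monomial)
  have br: "br x y \<in> carrier L" using closed(3) x y .
  have "(\<lambda>w. monomial [x, y] w - monomial [y, x] w - monomial [br x y] w) \<in> env_relators L br"
    unfolding env_relators_def
    by (rule UnI2, intro CollectI exI[of _ x] exI[of _ y] conjI HOL.refl x y)
  note rel = subsetD[OF env_relators_in_ideal this]
  have "coset (monomial [x, y]) = coset (\<lambda>w. monomial [y, x] w + monomial [br x y] w)"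
  proof (rule coset_diff_eq)
    show "(\<lambda>w. monomial [x, y] w - (monomial [y, x] w + monomial [br x y] w)) \<in> env_ideal L br"
      using rel by (simp only: diff_diff_eq)
  qed (use x y br mono mono2 lincomb_free_alg_closed[OF mono2 mono, of y x "br x y" 1 1] in auto)
  also have "\<dots> = coset (monomial [y, x]) \<oplus>\<^bsub>env_alg L br\<^esub> coset (monomial [br x y])"
    using ring_hom_add[OF coset_hom, of "monomial [y, x]" "monomial [br x y]"] x y br mono mono2
    by (simp add: free_alg_simps(5))
  finally show ?thesis using x y by (simp add: prod) (simp add: env_incl_def)
qed

end

section \<open>The matrix exponential\<close>

text \<open>The sum of the moduli of all entries serves as a crude norm: each further factor
  \<open>A\<close> contributes at most one column sum, which is bounded by the total.\<close>

lemma pow_mat_entry_bound: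
  assumes A: "A \<in> carrier_mat m m" and ij: "i < m" "j < m"
  shows "cmod ((A ^\<^sub>m k) $$ (i, j)) \<le> (\<Sum>a<m. \<Sum>b<m. cmod (A $$ (a, b))) ^ k"
  using ij(2)
proof (induction k arbitrary: j)
  case 0
  then show ?case using A ij by simp
next
  case (Suc k)
  let ?c = "\<Sum>a<m. \<Sum>b<m. cmod (A $$ (a, b))"
  have c: "0 \<le> ?c" by (intro sum_nonneg) auto
  have Ak: "A ^\<^sub>m k \<in> carrier_mat m m" using A by simp
  have "(A ^\<^sub>m Suc k) $$ (i, j) = (\<Sum>l<m. (A ^\<^sub>m k) $$ (i, l) * A $$ (l, j))"
    using A Ak ij Suc.prems by (simp add: scalar_prod_def atLeast0LessThan)
  then have "cmod ((A ^\<^sub>m Suc k) $$ (i, j)) \<le> (\<Sum>l<m. ?c ^ k * cmod (A $$ (l, j)))"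
    using Suc.IH by (auto simp: norm_mult intro!: sum_norm_le mult_right_mono)
  also have "\<dots> = ?c ^ k * (\<Sum>l<m. cmod (A $$ (l, j)))" by (simp add: sum_distrib_left)
  also have "\<dots> \<le> ?c ^ k * ?c"
    using Suc.prems c by (intro mult_left_mono sum_mono member_le_sum[of j "{..<m}"]) auto
  finally show ?case by (simp add: mult.commute)
qed

text \<open>Comparison with a real exponential series. Absolute convergence is what the Cauchy
  product in \<open>mat_exp_mult_uminus\<close> requires.\<close>

lemma summable_norm_mat_exp:
  fixes A :: "complex mat"
  assumes "A \<in> carrier_mat m m" "i < m" "j < m"
  shows "summable (\<lambda>k. norm ((A ^\<^sub>m k) $$ (i, j) / fact k))"
proof (rule summable_comparison_test')
  let ?c = "\<Sum>a<m. \<Sum>b<m. cmod (A $$ (a, b))"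
  show "summable (\<lambda>k. ?c ^ k / fact k)"
    using summable_exp_generic[of ?c] by (simp add: field_simps scaleR_conv_of_real)
  show "norm (norm ((A ^\<^sub>m k) $$ (i, j) / fact k)) \<le> ?c ^ k / fact k" if "k \<ge> 0" for k
    using pow_mat_entry_bound[OF assms, of k] by (simp add: norm_divide divide_right_mono)
qed

lemma dim_mat_exp [simp]: "dim_row (mat_exp A) = dim_row A" "dim_col (mat_exp A) = dim_col A"
  by (simp_all add: mat_exp_def)

lemma mat_exp_carrier: "A \<in> carrier_mat m m \<Longrightarrow> mat_exp A \<in> carrier_mat m m"
  by (auto simp: mat_exp_def)

lemma mat_exp_sums:
  assumes "A \<in> carrier_mat m m" "i < m" "j < m"
  shows "(\<lambda>k. (A ^\<^sub>m k) $$ (i, j) / fact k) sums (mat_exp A $$ (i, j))"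
  using summable_sums[OF summable_norm_cancel[OF summable_norm_mat_exp[OF assms]]] assms
  by (simp add: mat_exp_def)

lemma mult_mat_exp_sums:
  assumes A: "A \<in> carrier_mat m m" and P: "P \<in> carrier_mat m m" and ij: "i < m" "j < m"
  shows "(\<lambda>k. (P * A ^\<^sub>m k) $$ (i, j) / fact k) sums ((P * mat_exp A) $$ (i, j))"
proof -
  have E: "mat_exp A \<in> carrier_mat m m" and Ak: "A ^\<^sub>m k \<in> carrier_mat m m" for k
    using A by (auto intro: mat_exp_carrier)
  have "(\<lambda>k. \<Sum>l<m. P $$ (i, l) * ((A ^\<^sub>m k) $$ (l, j) / fact k)) sums
      (\<Sum>l<m. P $$ (i, l) * mat_exp A $$ (l, j))"
    using A ij by (intro sums_sum sums_mult mat_exp_sums) auto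
  then show ?thesis
    using E Ak A P ij by (simp add: scalar_prod_def atLeast0LessThan sum_divide_distrib)
qed

lemma mat_exp_mult_sums:
  assumes A: "A \<in> carrier_mat m m" and P: "P \<in> carrier_mat m m" and ij: "i < m" "j < m"
  shows "(\<lambda>k. (A ^\<^sub>m k * P) $$ (i, j) / fact k) sums ((mat_exp A * P) $$ (i, j))"
proof -
  have E: "mat_exp A \<in> carrier_mat m m" and Ak: "A ^\<^sub>m k \<in> carrier_mat m m" for k
    using A by (auto intro: mat_exp_carrier)
  have "(\<lambda>k. \<Sum>l<m. (A ^\<^sub>m k) $$ (i, l) / fact k * P $$ (l, j)) sums
      (\<Sum>l<m. mat_exp A $$ (i, l) * P $$ (l, j))"
    using A ij by (intro sums_sum sums_mult2 mat_exp_sums) auto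
  then show ?thesis
    using E Ak A P ij by (simp add: scalar_prod_def atLeast0LessThan sum_divide_distrib)
qed

text \<open>The relation passes to all powers by induction and then, entry by entry, to the series.
  With \<open>A = B\<close> it gives commutation; with the triple product of exponentials as
  \<open>P\<close> it gives the braid relation.\<close>

lemma mat_exp_intertwine:
  assumes A: "A \<in> carrier_mat m m" and B: "B \<in> carrier_mat m m" and P: "P \<in> carrier_mat m m"
    and PA: "P * A = B * P"
  shows "P * mat_exp A = mat_exp B * P"
proof (rule eq_matI)
  have pow: "P * A ^\<^sub>m k = B ^\<^sub>m k * P" for k
  proof (induction k)
    case (Suc k)
    have "P * A ^\<^sub>m Suc k = P * A ^\<^sub>m k * A"
      using A P by (simp add: assoc_mult_mat[of _ m m _ m _ m])
    also have "\<dots> = B ^\<^sub>m k * (B * P)"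
      using A B P PA by (simp add: Suc.IH assoc_mult_mat[of _ m m _ m _ m])
    also have "\<dots> = B ^\<^sub>m Suc k * P"
      using B P by (simp add: assoc_mult_mat[of _ m m _ m _ m])
    finally show ?case .
  qed (use A B P in simp)
  fix i j assume "i < dim_row (mat_exp B * P)" "j < dim_col (mat_exp B * P)"
  then have ij: "i < m" "j < m" using B P by auto
  show "(P * mat_exp A) $$ (i, j) = (mat_exp B * P) $$ (i, j)"
    by (rule sums_unique2[OF mult_mat_exp_sums[OF A P ij, unfolded pow] mat_exp_mult_sums[OF B P ij]])
qed (use A B P in \<open>auto simp: mat_exp_def\<close>)

section \<open>The inverse of a matrix exponential\<close>

lemma pow_mat_add_mult:
  assumes "A \<in> carrier_mat m m"
  shows "A ^\<^sub>m k * A ^\<^sub>m l = A ^\<^sub>m (k + l)"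
  using assms by (induction l) (simp_all add: assoc_mult_mat[of _ m m _ m _ m, symmetric])

lemma pow_mat_uminus:
  assumes "A \<in> carrier_mat m m"
  shows "(- A) ^\<^sub>m k = (-1) ^ k \<cdot>\<^sub>m (A ^\<^sub>m k :: complex mat)"
proof (induction k)
  case (Suc k)
  then show ?case using assms by (intro eq_matI) (auto simp: scalar_prod_def sum_negf sum_distrib_left mult.assoc)
qed (use assms in \<open>auto intro!: eq_matI\<close>)

text \<open>In the Cauchy product the term of degree \<open>k\<close> is
  \<open>A ^\<^sub>m k / fact k\<close> times the alternating sum of the binomial coefficients,
  which vanishes for \<open>k > 0\<close>.\<close>

lemma mat_exp_mult_uminus:
  assumes A: "A \<in> carrier_mat m m"
  shows "mat_exp A * mat_exp (- A) = 1\<^sub>m m"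
proof (rule eq_matI)
  fix i j assume "i < dim_row (1\<^sub>m m)" "j < dim_col (1\<^sub>m m)"
  then have ij: "i < m" "j < m" by auto
  have mA: "- A \<in> carrier_mat m m" and Ak: "A ^\<^sub>m k \<in> carrier_mat m m" for k using A by auto
  have "(\<lambda>k. \<Sum>l<m. \<Sum>p\<le>k. (A ^\<^sub>m p) $$ (i, l) / fact p * (((- A) ^\<^sub>m (k - p)) $$ (l, j) / fact (k - p)))
      sums (\<Sum>l<m. mat_exp A $$ (i, l) * mat_exp (- A) $$ (l, j))" (is "?S sums _")
  proof (rule sums_sum)
    fix l assume "l \<in> {..<m}"
    then have l: "l < m" by simp
    show "(\<lambda>k. \<Sum>p\<le>k. (A ^\<^sub>m p) $$ (i, l) / fact p * (((- A) ^\<^sub>m (k - p)) $$ (l, j) / fact (k - p)))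
      sums (mat_exp A $$ (i, l) * mat_exp (- A) $$ (l, j))"
      using Cauchy_product_sums[OF summable_norm_mat_exp[OF A ij(1) l] summable_norm_mat_exp[OF mA l ij(2)]]
      by (simp add: sums_unique[OF mat_exp_sums[OF A ij(1) l], symmetric]
          sums_unique[OF mat_exp_sums[OF mA l ij(2)], symmetric])
  qed
  moreover have "?S k = (if k = 0 then 1\<^sub>m m $$ (i, j) else 0)" for k
  proof -
    \<comment> \<open>After the exchange the inner sum over \<open>l\<close> is an entry of the
      product of the powers with exponents \<open>p\<close> and \<open>k - p\<close>.\<close>
    have "?S k = (\<Sum>p\<le>k. \<Sum>l<m. (A ^\<^sub>m p) $$ (i, l) / fact p * (((- A) ^\<^sub>m (k - p)) $$ (l, j) / fact (k - p)))"
      by (rule sum.swap)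
    also have "\<dots> = (\<Sum>p\<le>k. (A ^\<^sub>m k) $$ (i, j) / fact k * ((-1) ^ (k - p) * of_nat (k choose (k - p))))"
    proof (rule sum.cong[OF HOL.refl])
      fix p assume "p \<in> {..k}"
      then have p: "p \<le> k" by simp
      have "(A ^\<^sub>m k) $$ (i, j) = (A ^\<^sub>m p * A ^\<^sub>m (k - p)) $$ (i, j)"
        using p pow_mat_add_mult[OF A] by simp
      also have "\<dots> = (\<Sum>l<m. (A ^\<^sub>m p) $$ (i, l) * (A ^\<^sub>m (k - p)) $$ (l, j))"
        using Ak A ij by (simp add: scalar_prod_def atLeast0LessThan)
      finally show "(\<Sum>l<m. (A ^\<^sub>m p) $$ (i, l) / fact p * (((- A) ^\<^sub>m (k - p)) $$ (l, j) / fact (k - p))) =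
          (A ^\<^sub>m k) $$ (i, j) / fact k * ((-1) ^ (k - p) * of_nat (k choose (k - p)))"
        using p A ij Ak
        by (simp add: pow_mat_uminus[OF A] binomial_fact sum_distrib_left sum_distrib_right
            sum_divide_distrib field_simps)
    qed
    also have "\<dots> = (A ^\<^sub>m k) $$ (i, j) / fact k * (\<Sum>p\<le>k. (-1) ^ p * of_nat (k choose p))"
      unfolding sum_distrib_left[symmetric]
      by (rule arg_cong[of _ _ "(*) _"], rule sum.reindex_bij_witness[of _ "\<lambda>p. k - p" "\<lambda>p. k - p"]) auto
    also have "\<dots> = (if k = 0 then 1\<^sub>m m $$ (i, j) else 0)"
      using A by (auto simp: choose_alternating_sum)
    finally show ?thesis .
  qed
  ultimately have "(\<lambda>k. if k = 0 then 1\<^sub>m m $$ (i, j) else 0) sums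
      (\<Sum>l<m. mat_exp A $$ (i, l) * mat_exp (- A) $$ (l, j))" by simp
  then have "(\<Sum>l<m. mat_exp A $$ (i, l) * mat_exp (- A) $$ (l, j)) = 1\<^sub>m m $$ (i, j)"
    by (rule sums_unique2[OF _ sums_single[of 0 "\<lambda>_. 1\<^sub>m m $$ (i, j)"]])
  then show "(mat_exp A * mat_exp (- A)) $$ (i, j) = 1\<^sub>m m $$ (i, j)"
    using ij A by (simp add: scalar_prod_def atLeast0LessThan)
qed (use A in \<open>auto simp: mat_exp_def\<close>)

section \<open>Conjugation by a matrix exponential\<close>

lemma sums_index_shift_fact:
  fixes f :: "nat \<Rightarrow> complex"
  assumes "(\<lambda>k. f k / fact k) sums s"
  shows "(\<lambda>k. of_nat k * f (k - 1) / fact k) sums s"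
proof -
  \<comment> \<open>The term at index 0 has the factor 0, so the truncated value of
    \<open>k - 1\<close> there is harmless and the series is merely shifted by one.\<close>
  have "of_nat (Suc k) * f k / fact (Suc k) = f k / fact k" for k
    unfolding fact_Suc of_nat_mult by (simp del: of_nat_Suc)
  then have "(\<lambda>k. of_nat (Suc k) * f (Suc k - 1) / fact (Suc k)) sums s"
    using assms by simp
  then show ?thesis
    using sums_Suc[of "\<lambda>k. of_nat k * f (k - 1) / fact k" s] by simp
qed

text \<open>The formula \<open>exp(ad x)(y) = y + [x, y] + [x, [x, y]] / 2\<close> for \<open>(ad x)\<^sup>3 y = 0\<close>.\<close>

lemma mat_exp_conjugate:
  assumes x: "x \<in> carrier_mat m m" and y: "y \<in> carrier_mat m m"
    and z: "z \<in> carrier_mat m m" and w: "w \<in> carrier_mat m m"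
    and xy: "x * y = y * x + z" and xz: "x * z = z * x + 2 \<cdot>\<^sub>m w" and xw: "x * w = w * x"
  shows "mat_exp x * y = (y + z + w) * mat_exp x"
proof (rule eq_matI)
  note assoc = assoc_mult_mat[of _ m m _ m _ m]
  have xk [simp]: "x ^\<^sub>m k \<in> carrier_mat m m" for k using x by auto
  have Suc_pow: "x ^\<^sub>m Suc k = x * x ^\<^sub>m k" for k
    using pow_mat_add_mult[OF x, of 1 k] x by simp
  \<comment> \<open>The expansion of x^k y as the sum of (k choose i) (ad x)^i(y) x^(k-i), cut off
    at i = 2. As \<open>w\<close> is half of the double bracket, its coefficient is 2 (k choose 2) =
    k (k - 1). For small \<open>k\<close> the truncated exponents are multiplied by 0.\<close>
  define R :: "nat \<Rightarrow> complex mat" where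
    "R k = y * x ^\<^sub>m k + of_nat k \<cdot>\<^sub>m (z * x ^\<^sub>m (k - 1))
      + of_nat (k * (k - 1)) \<cdot>\<^sub>m (w * x ^\<^sub>m (k - 2))" for k
  have pow: "x ^\<^sub>m k * y = R k" for k
  proof (induction k)
    case 0
    show ?case using x y z w by (intro eq_matI) (auto simp: R_def)
  next
    case (Suc k)
    have y': "x * (y * x ^\<^sub>m k) = y * x ^\<^sub>m Suc k + z * x ^\<^sub>m k"
      unfolding Suc_pow using x y z
      by (simp add: assoc[symmetric] xy add_mult_distrib_mat[of _ m m _ _ m])
    have z': "x * (z * x ^\<^sub>m l) = z * x ^\<^sub>m Suc l + 2 \<cdot>\<^sub>m (w * x ^\<^sub>m l)" for l
      unfolding Suc_pow using x z w
      by (simp add: assoc[symmetric] xz add_mult_distrib_mat[of _ m m _ _ m]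
        mult_smult_assoc_mat[of _ m m _ m])
    have w': "x * (w * x ^\<^sub>m l) = w * x ^\<^sub>m Suc l" for l
      unfolding Suc_pow using x w by (simp add: assoc[symmetric] xw)
    have "x ^\<^sub>m Suc k * y = x * R k"
      unfolding Suc_pow using x y by (simp add: assoc Suc.IH)
    also have "\<dots> = x * (y * x ^\<^sub>m k) + of_nat k \<cdot>\<^sub>m (x * (z * x ^\<^sub>m (k - 1)))
      + of_nat (k * (k - 1)) \<cdot>\<^sub>m (x * (w * x ^\<^sub>m (k - 2)))"
      unfolding R_def using x y z w
      by (simp add: mult_add_distrib_mat[of _ m m _ m] mult_smult_distrib[of _ m m _ m])
    also have "\<dots> = R (Suc k)"
    \<comment> \<open>For \<open>k < 2\<close> the exponents \<open>k - 1\<close> and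
      \<open>k - 2\<close> may be truncated; from 2 on they are genuine differences.\<close>
    proof (cases "k < 2")
      case True
      then have "k = 0 \<or> k = 1" by auto
      then show ?thesis
        unfolding y' z' w' R_def using x y z w
        by (intro eq_matI) (auto simp: algebra_simps)
    next
      case False
      then obtain l where k: "k = Suc (Suc l)"
        by (metis Suc_leI add_2_eq_Suc le_Suc_ex not_less_eq numeral_2_eq_2)
      show ?thesis
        unfolding y' z' w' R_def using x y z w
        by (intro eq_matI) (simp_all del: pow_mat.simps add: k algebra_simps)
    qed
    finally show ?case .
  qed
  fix i j
  assume "i < dim_row ((y + z + w) * mat_exp x)" "j < dim_col ((y + z + w) * mat_exp x)"
  then have ij: "i < m" "j < m" using x w by auto
  have s: "(\<lambda>k. (a * x ^\<^sub>m k) $$ (i, j) / fact k) sums ((a * mat_exp x) $$ (i, j))"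
    if "a \<in> carrier_mat m m" for a
    using mult_mat_exp_sums[OF x that ij] .
  \<comment> \<open>The index is shifted once for \<open>z\<close> and twice for \<open>w\<close>,
    which produces the exponent \<open>k - 1 - 1\<close>.\<close>
  have "(\<lambda>k. (y * x ^\<^sub>m k) $$ (i, j) / fact k + of_nat k * (z * x ^\<^sub>m (k - 1)) $$ (i, j) / fact k
      + of_nat k * (of_nat (k - 1) * (w * x ^\<^sub>m (k - 1 - 1)) $$ (i, j)) / fact k) sums
    ((y * mat_exp x) $$ (i, j) + (z * mat_exp x) $$ (i, j) + (w * mat_exp x) $$ (i, j))"
    using y z w by (intro sums_add sums_index_shift_fact s)
  moreover have "(x ^\<^sub>m k * y) $$ (i, j) / fact k =
      (y * x ^\<^sub>m k) $$ (i, j) / fact k + of_nat k * (z * x ^\<^sub>m (k - 1)) $$ (i, j) / fact k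
      + of_nat k * (of_nat (k - 1) * (w * x ^\<^sub>m (k - 1 - 1)) $$ (i, j)) / fact k" for k
    unfolding pow R_def using x y z w ij by (simp add: add_divide_distrib numeral_2_eq_2)
  ultimately have "(mat_exp x * y) $$ (i, j) =
    (y * mat_exp x) $$ (i, j) + (z * mat_exp x) $$ (i, j) + (w * mat_exp x) $$ (i, j)"
    using mat_exp_mult_sums[OF x y ij] by (simp add: sums_unique2)
  also have "\<dots> = ((y + z + w) * mat_exp x) $$ (i, j)"
    using x y z w ij mat_exp_carrier[OF x] by (simp add: add_mult_distrib_mat[of _ m m _ _ m] del: index_mult_mat(1))
  finally show "(mat_exp x * y) $$ (i, j) = ((y + z + w) * mat_exp x) $$ (i, j)" .
qed (use x y z w in auto)

section \<open>Relations between matrix exponentials\<close>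

lemma mat_exp_commute:
  assumes A: "A \<in> carrier_mat m m" and B: "B \<in> carrier_mat m m" and "A * B = B * A"
  shows "mat_exp A * mat_exp B = mat_exp B * mat_exp A"
  using assms by (intro mat_exp_intertwine[of _ m] mat_exp_carrier mat_exp_intertwine[of _ m, symmetric]) auto

lemma mat_exp_Units:
  assumes "A \<in> carrier_mat m m"
  shows "mat_exp A \<in> Units (ring_mat TYPE(complex) m ())"
proof -
  have "mat_exp (- A) * mat_exp A = 1\<^sub>m m"
    using mat_exp_mult_uminus[of "- A" m] assms by simp
  then show ?thesis
    using assms mat_exp_mult_uminus[OF assms] mat_exp_carrier[OF assms]
      mat_exp_carrier[of "- A" m]
    by (auto simp: Units_def ring_mat_simps)
qed

text \<open>Conjugation by \<open>exp q exp p exp q\<close> carries \<open>q\<close> to \<open>p\<close>.\<close>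

lemma mat_exp_braid:
  assumes p: "p \<in> carrier_mat m m" and q: "q \<in> carrier_mat m m" and h: "h \<in> carrier_mat m m"
    and pq: "p * q = q * p + h" and ph: "p * h = h * p + 2 \<cdot>\<^sub>m p" and qh: "q * h + 2 \<cdot>\<^sub>m q = h * q"
  shows "mat_exp p * mat_exp q * mat_exp p = mat_exp q * mat_exp p * mat_exp q"
proof -
  note assoc = assoc_mult_mat[of _ m m _ m _ m]
  note distrib = add_mult_distrib_mat[of _ m m _ _ m] mult_add_distrib_mat[of _ m m _ m]
  \<comment> \<open>Below, \<open>s\<close> is exp(ad p)(q), the sum of q, [p, q] = h and [p, h] / 2
    = p. Then \<open>?z\<close> is [q, s] = -h - 2 q, and [q, ?z] = 2 q, so exp(ad q)(s) = s + ?z +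
    q = p.\<close>
  let ?A = "mat_exp q" and ?B = "mat_exp p" and ?z = "- (h + 2 \<cdot>\<^sub>m q)"
  define s where "s = q + h + p"
  have s: "s \<in> carrier_mat m m" using p q h by (simp add: s_def)
  have A: "?A \<in> carrier_mat m m" and B: "?B \<in> carrier_mat m m" using p q by (auto intro: mat_exp_carrier)
  have B': "?B * q = s * ?B"
    unfolding s_def by (rule mat_exp_conjugate) (use p q h pq ph in auto)
  have qs: "q * s = s * q + ?z"
  proof (rule eq_matI)
    fix i j assume "i < dim_row (s * q + ?z)" "j < dim_col (s * q + ?z)"
    then have ij: "i < m" "j < m" using s q by auto
    have "(p * q) $$ (i, j) = (q * p) $$ (i, j) + h $$ (i, j)"
      using ij p q h unfolding pq by simp
    moreover have "(h * q) $$ (i, j) = (q * h) $$ (i, j) + 2 * q $$ (i, j)"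
      using ij p q h unfolding qh[symmetric] by simp
    ultimately show "(q * s) $$ (i, j) = (s * q + ?z) $$ (i, j)"
      using ij p q h by (simp add: s_def distrib del: index_mult_mat(1))
  qed (use p q h s in auto)
  have qz: "q * ?z = ?z * q + 2 \<cdot>\<^sub>m q"
  proof (rule eq_matI)
    fix i j assume "i < dim_row (?z * q + 2 \<cdot>\<^sub>m q)" "j < dim_col (?z * q + 2 \<cdot>\<^sub>m q)"
    then have ij: "i < m" "j < m" using q by auto
    have "(h * q) $$ (i, j) = (q * h) $$ (i, j) + 2 * q $$ (i, j)"
      using ij p q h unfolding qh[symmetric] by simp
    then show "(q * ?z) $$ (i, j) = (?z * q + 2 \<cdot>\<^sub>m q) $$ (i, j)"
      using ij p q h by (simp add: distrib mult_smult_distrib[of _ m m _ m]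
          mult_smult_assoc_mat[of _ m m _ m] del: index_mult_mat(1))
  qed (use p q h in auto)
  have "?A * s = (s + ?z + q) * ?A"
    by (rule mat_exp_conjugate) (use q h s qs qz in auto)
  also have "s + ?z + q = p"
    using p q h by (intro eq_matI) (auto simp: s_def)
  finally have A': "?A * s = p * ?A" .
  \<comment> \<open>Moving \<open>q\<close> to the left: it commutes with exp q, becomes
    \<open>s\<close> when passing exp p, and \<open>s\<close> becomes \<open>p\<close> when passing
    the other exp q.\<close>
  have "?A * ?B * ?A * q = ?A * ?B * (q * ?A)"
    using A B q mat_exp_intertwine[OF q q q] by (simp add: assoc)
  also have "\<dots> = ?A * (?B * q) * ?A"
    using A B q by (simp add: assoc)
  also have "\<dots> = ?A * s * (?B * ?A)"
    unfolding B' using A B s by (simp add: assoc)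
  also have "\<dots> = p * (?A * ?B * ?A)"
    unfolding A' using A B p q h by (simp add: assoc)
  \<comment> \<open>Exponentiating the intertwining relation gives A B A A = B A B A; cancelling the
    last factor A with exp(-q) leaves the braid relation.\<close>
  finally have "?A * ?B * ?A * ?A = ?B * (?A * ?B * ?A)"
    using A B p q by (intro mat_exp_intertwine) auto
  then have "?A * ?B * ?A * ?A * mat_exp (- q) = ?B * (?A * ?B * ?A) * mat_exp (- q)"
    by (simp only:)
  then show ?thesis
    using A B q mat_exp_carrier[of "- q" m] by (simp add: assoc mat_exp_mult_uminus right_mult_one_mat[OF A] right_mult_one_mat[OF B])
qed

section \<open>Matrices in the special linear Lie algebra\<close>

lemma sl_simps:
  "carrier (sl N) = {A \<in> carrier_mat N N. (\<Sum>i<N. A $$ (i, i)) = 0}"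
  "A \<oplus>\<^bsub>sl N\<^esub> B = A + B"
  "c \<odot>\<^bsub>sl N\<^esub> A = c \<cdot>\<^sub>m A"
  by (simp_all add: sl_def module_mat_simps)

lemma commutator_sl:
  assumes "A \<in> carrier (sl N)" "B \<in> carrier (sl N)"
  shows "commutator A B \<in> carrier (sl N)"
proof -
  have A: "A \<in> carrier_mat N N" and B: "B \<in> carrier_mat N N"
    using assms by (auto simp: sl_simps)
  have "(\<Sum>i<N. (A * B) $$ (i, i)) = (\<Sum>i<N. \<Sum>j<N. A $$ (i, j) * B $$ (j, i))"
    using A B by (simp add: scalar_prod_def atLeast0LessThan)
  also have "\<dots> = (\<Sum>j<N. \<Sum>i<N. A $$ (i, j) * B $$ (j, i))"
    by (rule sum.swap)
  also have "\<dots> = (\<Sum>i<N. (B * A) $$ (i, i))"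
    using A B by (simp add: scalar_prod_def atLeast0LessThan mult.commute)
  finally show ?thesis
    using A B
    by (auto simp: sl_simps commutator_def sum_subtractf simp del: index_mult_mat(1)
        intro!: minus_carrier_mat)
qed

lemma sl_closed:
  "A \<in> carrier (sl N) \<Longrightarrow> B \<in> carrier (sl N) \<Longrightarrow> A \<oplus>\<^bsub>sl N\<^esub> B \<in> carrier (sl N)"
  "A \<in> carrier (sl N) \<Longrightarrow> c \<odot>\<^bsub>sl N\<^esub> A \<in> carrier (sl N)"
  by (auto simp: sl_simps sum.distrib sum_distrib_left[symmetric])

lemma matrix_unit_sl: "i \<noteq> j \<Longrightarrow> matrix_unit N i j \<in> carrier (sl N)"
  by (auto simp: sl_simps matrix_unit_def intro!: sum.neutral)

text \<open>The generator attached to \<open>\<sigma>\<^sub>k\<close>; since the matrix units with an index \<open>0\<close> or \<open>N + 1\<close>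
  vanish, the formula also covers \<open>k = 1\<close> and \<open>k = N\<close>.\<close>

definition braid_mat :: "nat \<Rightarrow> nat \<Rightarrow> complex mat" where
  "braid_mat N k = matrix_unit N (k - 1) k - matrix_unit N (k + 1) k"

lemma braid_mat_carrier [simp]: "braid_mat N k \<in> carrier_mat N N"
  by (auto simp: braid_mat_def matrix_unit_def intro!: minus_carrier_mat)

lemma dim_braid_mat [simp]: "dim_row (braid_mat N k) = N" "dim_col (braid_mat N k) = N"
  using braid_mat_carrier[of N k] by blast+

lemma braid_mat_sl:
  assumes "k \<ge> 1"
  shows "braid_mat N k \<in> carrier (sl N)"
  using assms braid_mat_carrier[of N k]
  by (auto simp: sl_simps braid_mat_def matrix_unit_def intro!: sum.neutral)

text \<open>The only nonzero column of \<open>braid_mat N k\<close>, with rows numbered from 0: row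
  k - 1 of the usual numbering is \<open>a + 2 = k\<close>, and row k + 1 is \<open>a = k\<close>.
  The column itself has index \<open>k - 1\<close>.\<close>

definition braid_col :: "nat \<Rightarrow> nat \<Rightarrow> complex" where
  "braid_col k a = (if a + 2 = k then 1 else 0) - (if a = k then 1 else 0)"

lemma braid_mat_index:
  assumes "k \<ge> 1" "a < N" "b < N"
  shows "braid_mat N k $$ (a, b) = (if b = k - 1 then braid_col k a else 0)"
  using assms by (auto simp: braid_mat_def matrix_unit_def braid_col_def)

text \<open>With a single nonzero column only one summand survives, so products of these matrices
  reduce to products of scalars.\<close>

lemma braid_mat_mult_index:
  assumes "k \<in> {1..N}" "M \<in> carrier_mat N N" "a < N" "b < N"
  shows "(braid_mat N k * M) $$ (a, b) = braid_col k a * M $$ (k - 1, b)"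
proof -
  have "(braid_mat N k * M) $$ (a, b) = (\<Sum>l<N. braid_mat N k $$ (a, l) * M $$ (l, b))"
    using assms by (simp add: scalar_prod_def atLeast0LessThan)
  also have "\<dots> = (\<Sum>l<N. if l = k - 1 then braid_col k a * M $$ (l, b) else 0)"
    using assms by (intro sum.cong) (auto simp: braid_mat_index)
  finally show ?thesis using assms by auto
qed

text \<open>The product is governed by the scalar \<open>braid_col j (i - 1)\<close>, which is
  nonzero only for adjacent indices. The case \<open>i = j\<close> is included and gives the
  vanishing squares.\<close>

lemma braid_mat_mult_zero:
  assumes "i \<in> {1..N}" "j \<in> {1..N}" "j \<noteq> i + 1" "i \<noteq> j + 1"
  shows "braid_mat N i * braid_mat N j = 0\<^sub>m N N"
proof (rule eq_matI)
  show "(braid_mat N i * braid_mat N j) $$ (a, b) = 0\<^sub>m N N $$ (a, b)"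
    if "a < dim_row (0\<^sub>m N N)" "b < dim_col (0\<^sub>m N N)" for a b
    using that assms
    by (auto simp: braid_mat_mult_index braid_mat_index braid_col_def simp del: index_mult_mat(1))
qed simp_all

text \<open>The scalar is now \<open>braid_col j (i - 1) * braid_col i (j - 1)\<close>; for adjacent
  indices one factor is 1 and the other is -1.\<close>

lemma braid_mat_triple:
  assumes "i \<in> {1..N}" "j \<in> {1..N}" "j = i + 1 \<or> i = j + 1"
  shows "braid_mat N i * (braid_mat N j * braid_mat N i) = - braid_mat N i"
proof (rule eq_matI)
  show "(braid_mat N i * (braid_mat N j * braid_mat N i)) $$ (a, b) = (- braid_mat N i) $$ (a, b)"
    if "a < dim_row (- braid_mat N i)" "b < dim_col (- braid_mat N i)" for a b
  proof -
    have "a < N" "b < N" using that by auto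
    then show ?thesis
      using assms mult_carrier_mat[of "braid_mat N j" N N "braid_mat N i" N]
      by (auto simp: braid_mat_mult_index braid_mat_index braid_col_def simp del: index_mult_mat(1))
  qed
qed simp_all

text \<open>Since A A = 0, expanding [A, [A, B]] leaves only -2 A B A = 2 A. The second form serves
  the same pair with its roles exchanged while the inner bracket keeps its order.\<close>

lemma commutator_commutator:
  assumes A: "A \<in> carrier_mat N N" and B: "B \<in> carrier_mat N N"
    and AA: "A * A = 0\<^sub>m N N" and ABA: "A * (B * A) = - A"
  shows "commutator A (commutator A B) = 2 \<cdot>\<^sub>m A"
    and "commutator A (commutator B A) = (-2) \<cdot>\<^sub>m A"
proof -
  note assoc = assoc_mult_mat[of _ N N _ N _ N]
  have "A * (A * B) = 0\<^sub>m N N" "A * B * A = - A" "B * A * A = 0\<^sub>m N N"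
    using A B AA ABA by (simp_all add: assoc assoc[symmetric, of A A])
  note facts = this ABA
  have "A * (A * B - B * A) = A" "(A * B - B * A) * A = - A"
    "A * (B * A - A * B) = - A" "(B * A - A * B) * A = A"
    using A B
    by (auto simp: mult_minus_distrib_mat[of _ N N _ N] minus_mult_distrib_mat[of _ N N _ _ N] facts
        intro!: eq_matI)
  then show "commutator A (commutator A B) = 2 \<cdot>\<^sub>m A"
    and "commutator A (commutator B A) = (-2) \<cdot>\<^sub>m A"
    using A unfolding commutator_def by (auto intro!: eq_matI)
qed

section \<open>Representations of the special linear Lie algebra\<close>

lemma ring_U_sl: "ring (U_sl N)"
  unfolding U_sl_def by (rule ring_env_alg) (auto intro: sl_closed commutator_sl)

lemma U_incl_closed: "A \<in> carrier (sl N) \<Longrightarrow> U_incl N A \<in> carrier (U_sl N)"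
  unfolding U_sl_def U_incl_def by (rule env_incl_closed) (auto intro: sl_closed commutator_sl)

lemma U_incl_add:
  assumes "A \<in> carrier (sl N)" "B \<in> carrier (sl N)"
  shows "U_incl N (A + B) = U_incl N A \<oplus>\<^bsub>U_sl N\<^esub> U_incl N B"
  unfolding U_sl_def U_incl_def sl_simps(2)[where N = N, symmetric]
  using assms by (intro env_incl_add) (auto intro: sl_closed commutator_sl)

lemma U_incl_smult:
  assumes "A \<in> carrier (sl N)"
  shows "U_incl N (c \<cdot>\<^sub>m A) = c \<odot>\<^bsub>U_sl N\<^esub> U_incl N A"
  unfolding U_sl_def U_incl_def sl_simps(3)[where N = N, symmetric]
  using assms by (intro env_incl_smult) (auto intro: sl_closed commutator_sl)

lemma U_incl_bracket:
  assumes "A \<in> carrier (sl N)" "B \<in> carrier (sl N)"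
  shows "U_incl N A \<otimes>\<^bsub>U_sl N\<^esub> U_incl N B =
    U_incl N B \<otimes>\<^bsub>U_sl N\<^esub> U_incl N A \<oplus>\<^bsub>U_sl N\<^esub> U_incl N (commutator A B)"
  unfolding U_sl_def U_incl_def
  using assms by (intro env_incl_bracket) (auto intro: sl_closed commutator_sl)

locale sl_rep =
  fixes N m :: nat and \<rho> :: "env \<Rightarrow> complex mat"
  assumes rep: "is_rep N m \<rho>"
begin

definition r :: "complex mat \<Rightarrow> complex mat" where "r A = \<rho> (U_incl N A)"

lemma hom: "\<rho> \<in> Ring.ring_hom (U_sl N) (ring_mat TYPE(complex) m ())"
  and smult: "u \<in> carrier (U_sl N) \<Longrightarrow> \<rho> (c \<odot>\<^bsub>U_sl N\<^esub> u) = c \<cdot>\<^sub>m \<rho> u"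
  using rep by (auto simp: is_rep_def)

lemma rho_carrier: "u \<in> carrier (U_sl N) \<Longrightarrow> \<rho> u \<in> carrier_mat m m"
  using ring_hom_closed[OF hom] by (simp add: ring_mat_simps)

lemma r_carrier: "A \<in> carrier (sl N) \<Longrightarrow> r A \<in> carrier_mat m m"
  unfolding r_def by (intro rho_carrier U_incl_closed)

lemma r_add:
  assumes "A \<in> carrier (sl N)" "B \<in> carrier (sl N)"
  shows "r (A + B) = r A + r B"
  using ring_hom_add[OF hom U_incl_closed U_incl_closed] assms
  by (simp add: r_def U_incl_add ring_mat_simps)

lemma r_smult: "A \<in> carrier (sl N) \<Longrightarrow> r (c \<cdot>\<^sub>m A) = c \<cdot>\<^sub>m r A"
  by (simp add: r_def U_incl_smult U_incl_closed smult)

text \<open>Thus \<open>r\<close> is a Lie algebra representation, and this is how bracket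
  identities of the standard matrices reach the matrices of size \<open>m\<close>.\<close>

lemma r_mult:
  assumes A: "A \<in> carrier (sl N)" and B: "B \<in> carrier (sl N)"
  shows "r A * r B = r B * r A + r (commutator A B)"
proof -
  interpret U: ring "U_sl N" by (rule ring_U_sl)
  note c = U_incl_closed[OF A] U_incl_closed[OF B] U_incl_closed[OF commutator_sl[OF A B]]
  show ?thesis
    using arg_cong[OF U_incl_bracket[OF A B], of \<rho>] c
    by (simp add: r_def ring_hom_mult[OF hom] ring_hom_add[OF hom] ring_mat_simps)
qed

lemma r_uminus:
  assumes "A \<in> carrier (sl N)"
  shows "r (- A) = - r A"
proof -
  have "- A = (-1) \<cdot>\<^sub>m A" by (intro eq_matI) auto
  also have "r \<dots> = - r A" unfolding r_smult[OF assms] by (intro eq_matI) auto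
  finally show ?thesis .
qed

text \<open>A ring homomorphism is given as additive only, so the difference is recovered from (a -
  b) + b = a.\<close>

lemma rho_minus:
  assumes a: "a \<in> carrier (U_sl N)" and b: "b \<in> carrier (U_sl N)"
  shows "\<rho> (a \<ominus>\<^bsub>U_sl N\<^esub> b) = \<rho> a - \<rho> b"
proof -
  interpret U: ring "U_sl N" by (rule ring_U_sl)
  have "(a \<ominus>\<^bsub>U_sl N\<^esub> b) \<oplus>\<^bsub>U_sl N\<^esub> b = a"
    using a b by (simp add: a_minus_def U.a_assoc U.l_neg)
  then have "\<rho> a = \<rho> (a \<ominus>\<^bsub>U_sl N\<^esub> b) + \<rho> b"
    using ring_hom_add[OF hom, of "a \<ominus>\<^bsub>U_sl N\<^esub> b" b] a b by (simp add: ring_mat_simps)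
  moreover have "\<rho> (a \<ominus>\<^bsub>U_sl N\<^esub> b) \<in> carrier_mat m m" "\<rho> b \<in> carrier_mat m m"
    using a b by (auto intro: rho_carrier)
  ultimately show ?thesis by (auto intro!: eq_matI)
qed

lemma exp_braid:
  assumes "i \<in> {1..N}" "i + 1 \<in> {1..N}"
  shows "mat_exp (r (braid_mat N i)) * mat_exp (r (braid_mat N (i + 1))) * mat_exp (r (braid_mat N i)) =
    mat_exp (r (braid_mat N (i + 1))) * mat_exp (r (braid_mat N i)) * mat_exp (r (braid_mat N (i + 1)))"
proof -
  let ?A = "braid_mat N i" and ?B = "braid_mat N (i + 1)"
  have A: "?A \<in> carrier (sl N)" and B: "?B \<in> carrier (sl N)"
    using assms by (auto intro: braid_mat_sl)
  have H: "commutator ?A ?B \<in> carrier (sl N)" using A B by (rule commutator_sl)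
  have AH: "commutator ?A (commutator ?A ?B) = 2 \<cdot>\<^sub>m ?A"
    using assms by (intro commutator_commutator(1)[of _ N] braid_mat_mult_zero braid_mat_triple) auto
  have BH: "commutator ?B (commutator ?A ?B) = (-2) \<cdot>\<^sub>m ?B"
    using assms by (intro commutator_commutator(2)[of _ N] braid_mat_mult_zero braid_mat_triple) auto
  show ?thesis
  proof (rule mat_exp_braid)
    show "r ?A * r ?B = r ?B * r ?A + r (commutator ?A ?B)" by (rule r_mult[OF A B])
    show "r ?A * r (commutator ?A ?B) = r (commutator ?A ?B) * r ?A + 2 \<cdot>\<^sub>m r ?A"
      using r_mult[OF A H] unfolding AH r_smult[OF A] .
    have "r ?B * r (commutator ?A ?B) = r (commutator ?A ?B) * r ?B + (-2) \<cdot>\<^sub>m r ?B"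
      using r_mult[OF B H] unfolding BH r_smult[OF B] .
    then show "r ?B * r (commutator ?A ?B) + 2 \<cdot>\<^sub>m r ?B = r (commutator ?A ?B) * r ?B"
      using r_carrier[OF B] r_carrier[OF H]
      by (intro eq_matI) (auto simp del: index_mult_mat(1))
  qed (use A B H r_carrier in auto)
qed

lemma exp_commute:
  assumes "i \<in> {1..N}" "j \<in> {1..N}" "\<bar>int i - int j\<bar> \<ge> 2"
  shows "mat_exp (r (braid_mat N i)) * mat_exp (r (braid_mat N j)) =
    mat_exp (r (braid_mat N j)) * mat_exp (r (braid_mat N i))"
proof -
  let ?A = "braid_mat N i" and ?B = "braid_mat N j"
  have A: "?A \<in> carrier (sl N)" and B: "?B \<in> carrier (sl N)"
    using assms by (auto intro: braid_mat_sl)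
  have "commutator ?A ?B = 0\<^sub>m N N"
    using assms by (simp add: commutator_def braid_mat_mult_zero)
  \<comment> \<open>Written as a multiple of \<open>?A\<close>, the zero matrix is sent to zero by
    \<open>r_smult\<close>.\<close>
  also have "\<dots> = 0 \<cdot>\<^sub>m ?A" by (intro eq_matI) auto
  finally have "r (commutator ?A ?B) = 0\<^sub>m m m"
    using r_carrier[OF A] by (auto simp: r_smult[OF A] intro!: eq_matI)
  then have "r ?A * r ?B = r ?B * r ?A"
    using r_mult[OF A B] r_carrier[OF A] r_carrier[OF B] mult_carrier_mat[of "r ?B" m m "r ?A" m] by simp
  then show ?thesis using r_carrier[OF A] r_carrier[OF B] by (intro mat_exp_commute)
qed

lemma r_braid_mat_inner:
  assumes "k \<ge> 2"
  shows "r (braid_mat N k) = \<rho> (chev_E N (k - 1) \<ominus>\<^bsub>U_sl N\<^esub> chev_F N k)"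
proof -
  have E: "matrix_unit N (k - 1) k \<in> carrier (sl N)" and F: "matrix_unit N (k + 1) k \<in> carrier (sl N)"
    using assms by (auto intro: matrix_unit_sl)
  have F': "- matrix_unit N (k + 1) k \<in> carrier (sl N)"
    using F by (auto simp: sl_simps sum_negf)
  have "r (braid_mat N k) = r (matrix_unit N (k - 1) k + - matrix_unit N (k + 1) k)"
    unfolding braid_mat_def by (rule arg_cong[of _ _ r]) (auto simp: matrix_unit_def intro!: eq_matI)
  also have "\<dots> = r (matrix_unit N (k - 1) k) - r (matrix_unit N (k + 1) k)"
    unfolding r_add[OF E F'] r_uminus[OF F]
    using r_carrier[OF E] r_carrier[OF F] by (auto intro!: eq_matI)
  also have "\<dots> = \<rho> (chev_E N (k - 1) \<ominus>\<^bsub>U_sl N\<^esub> chev_F N k)"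
    using assms U_incl_closed[OF E] U_incl_closed[OF F]
    by (simp add: r_def chev_E_def chev_F_def rho_minus)
  finally show ?thesis .
qed

lemma r_braid_mat_first: "r (braid_mat N 1) = - \<rho> (chev_F N 1)"
proof -
  have "braid_mat N 1 = - matrix_unit N (1 + 1) 1"
    by (auto simp: braid_mat_def matrix_unit_def intro!: eq_matI)
  then show ?thesis by (simp add: r_uminus matrix_unit_sl) (simp add: r_def chev_F_def)
qed

lemma r_braid_mat_last: "N \<ge> 1 \<Longrightarrow> r (braid_mat N N) = \<rho> (chev_E N (N - 1))"
proof -
  assume "N \<ge> 1"
  have "braid_mat N N = matrix_unit N (N - 1) N"
    by (auto simp: braid_mat_def matrix_unit_def intro!: eq_matI)
  then show ?thesis using \<open>N \<ge> 1\<close> by (simp add: r_def chev_E_def)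
qed

end

theorem mainTheorem3:
  fixes n m :: nat and \<rho> :: "env \<Rightarrow> complex mat"
  assumes "n \<ge> 3"
    and "highest_weight_rep (n - 1) m \<rho>"
  shows "\<exists>\<phi> \<in> hom (braid_group n) (GL m).
     \<phi> (braid_gen n 1) = mat_exp (- \<rho> (chev_F (n - 1) 1)) \<and>
     (\<forall>k\<in>{2..n - 2}. \<phi> (braid_gen n k) =
        mat_exp (\<rho> (chev_E (n - 1) (k - 1) \<ominus>\<^bsub>U_sl (n - 1)\<^esub> chev_F (n - 1) k))) \<and>
     \<phi> (braid_gen n (n - 1)) = mat_exp (\<rho> (chev_E (n - 1) (n - 2)))"
proof -
  interpret sl_rep "n - 1" m \<rho>
    using assms(2) by unfold_locales (simp add: highest_weight_rep_def)
  interpret M: ring "ring_mat TYPE(complex) m ()" by (rule ring_mat)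
  interpret GL: group "GL m" unfolding GL_def by (rule M.units_group)
  \<comment> \<open>One formula for all generators, so that the relations need no case distinction
    at the ends of the chain. The three formulas of the statement are recovered afterwards; for
    \<open>n = 3\<close> the middle range is empty.\<close>
  define h where "h k = mat_exp (r (braid_mat (n - 1) k))" for k
  have h: "h ` {1..n - 1} \<subseteq> carrier (GL m)"
  proof (rule image_subsetI)
    fix k assume "k \<in> {1..n - 1}"
    then have "r (braid_mat (n - 1) k) \<in> carrier_mat m m"
      by (intro r_carrier braid_mat_sl) simp
    then show "h k \<in> carrier (GL m)"
      unfolding h_def GL_def units_of_carrier by (rule mat_exp_Units)
  qed
  have mult: "x \<otimes>\<^bsub>GL m\<^esub> y = x * y" for x y
    by (simp add: GL_def units_of_mult ring_mat_simps)
  have rels: "word_eval (GL m) h u = word_eval (GL m) h v" if uv: "(u, v) \<in> braid_relations n" for u v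
  proof -
    consider i where "i \<in> {1..n - 2}"
        "u = [(i, True), (i + 1, True), (i, True)]" "v = [(i + 1, True), (i, True), (i + 1, True)]"
      | i j where "i \<in> {1..n - 1}" "j \<in> {1..n - 1}" "\<bar>int i - int j\<bar> \<ge> 2"
        "u = [(i, True), (j, True)]" "v = [(j, True), (i, True)]"
      using uv unfolding braid_relations_def by blast
    then show ?thesis
    proof cases
      case (1 i)
      then have ij: "i \<in> {1..n - 1}" "i + 1 \<in> {1..n - 1}" using assms(1) by auto
      then have c: "h i \<in> carrier (GL m)" "h (i + 1) \<in> carrier (GL m)" using h by blast+
      have "h i \<otimes>\<^bsub>GL m\<^esub> h (i + 1) \<otimes>\<^bsub>GL m\<^esub> h i = h (i + 1) \<otimes>\<^bsub>GL m\<^esub> h i \<otimes>\<^bsub>GL m\<^esub> h (i + 1)"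
        unfolding mult h_def by (rule exp_braid[OF ij])
      then show ?thesis using 1 c by (simp add: word_eval_def GL.m_assoc)
    next
      case (2 i j)
      then have c: "h i \<in> carrier (GL m)" "h j \<in> carrier (GL m)" using h by blast+
      have "h i \<otimes>\<^bsub>GL m\<^esub> h j = h j \<otimes>\<^bsub>GL m\<^esub> h i"
        unfolding mult h_def by (rule exp_commute[OF 2(1-3)])
      then show ?thesis using 2 c by (simp add: word_eval_def)
    qed
  qed
  obtain \<phi> where \<phi>: "\<phi> \<in> hom (braid_group n) (GL m)"
    and gen: "\<And>k. k \<in> {1..n - 1} \<Longrightarrow> \<phi> (braid_gen n k) = h k"
    using GL.presented_group_hom_exists[OF h rels]
    unfolding braid_group_def braid_gen_def by blast
  have "\<phi> (braid_gen n 1) = mat_exp (- \<rho> (chev_F (n - 1) 1))"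
    using gen[of 1] assms(1) r_braid_mat_first by (simp add: h_def)
  moreover have "\<phi> (braid_gen n k) =
      mat_exp (\<rho> (chev_E (n - 1) (k - 1) \<ominus>\<^bsub>U_sl (n - 1)\<^esub> chev_F (n - 1) k))"
    if "k \<in> {2..n - 2}" for k
  proof -
    have "k \<in> {1..n - 1}" "k \<ge> 2" using that by auto
    then show ?thesis using gen r_braid_mat_inner unfolding h_def by simp
  qed
  moreover have "\<phi> (braid_gen n (n - 1)) = mat_exp (\<rho> (chev_E (n - 1) (n - 2)))"
    using gen[of "n - 1"] assms(1) r_braid_mat_last by (simp add: h_def numeral_2_eq_2)
  ultimately show ?thesis using \<phi> by blast
qed

end
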